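(* Let $\mathcal{H}$ be a Hilbert space and let $V\in L(\mathcal{H})$ be a partial isometry. Then $V\in\mathcal{J}_{\mathfrak{X}}$ if and only if $V^2V^*\ge 0$ and $\overline{R(V^2V^* )}=R(V)$. In this case, $\overline{R(V)\dot{+}N(V)}=\mathcal{H}$.
   Context: $L(\mathcal{H})$ is the algebra of bounded linear operators on $\mathcal{H}$; $R(\cdot)$ and $N(\cdot)$ denote range and nullspace; $B\ge 0$ means $B$ is self-adjoint with $\langle Bx,x\rangle\ge 0$ for all $x$. $\mathfrak{X}$ is the set of all products $PQ$ of two orthogonal projections $P,Q\in L(\mathcal{H})$. The polar decomposition of $C\in L(\mathcal{H})$ is the unique factorization $C=V_C|C|$ with $|C|=(C^*C)^{1/2}$ and $V_C$ a partial isometry with $N(V_C)=N(C)$; $V_C$ is the isometric part of $C$. $\mathcal{J}_{\mathfrak{X}}=\{V_T:T\in\mathfrak{X}\}$. $\mathcal{M}\dot{+}\mathcal{N}$ denotes the sum of closed subspaces with $\mathcal{M}\cap\mathcal{N}=\{0\}$. *)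

theory Defs
  imports "HOL-Analysis.Analysis" "HOL-Library.Set_Algebras" "HOL-Library.Nonpos_Ints"
begin

text \<open>
  The scalar field of a Hilbert space is either the reals or the complex numbers. Both are covered
  by the following class; by the Gelfand--Mazur theorem they are, up to isomorphism, its only members.
\<close>

class rc_field = real_normed_field +
  fixes conj :: "'a \<Rightarrow> 'a"
  assumes conj_add: "conj (x + y) = conj x + conj y"
    and conj_mult: "conj (x * y) = conj x * conj y"
    and conj_conj: "conj (conj x) = x"
    and mult_conj: "x * conj x = (norm x)\<^sup>2 *\<^sub>R 1"

instantiation real :: rc_field
begin
definition conj_real :: "real \<Rightarrow> real" where "conj_real x = x"
instance by standard (simp_all add: conj_real_def power2_eq_square)
end

instantiation complex :: rc_field
begin
definition conj_complex :: "complex \<Rightarrow> complex" where "conj_complex = cnj"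
instance by standard (simp_all add: conj_complex_def scaleR_conv_of_real complex_norm_square del: of_real_power)
end

text \<open>
  A Hilbert space over the scalar field \<open>'k\<close> on the type \<open>'v\<close>, with scalar multiplication
  \<open>sm\<close> and inner product \<open>ip\<close>, linear in the first argument. The class \<open>real_inner\<close> of \<open>'v\<close>
  provides the underlying real Hilbert space: by polarization, \<open>ip_self\<close> says that its inner
  product is the real part of \<open>ip\<close>, so norm and topology are those induced by \<open>ip\<close>.
\<close>

locale hilbert_space = vector_space sm
  for sm :: "'k::rc_field \<Rightarrow> 'v::{real_inner, complete_space} \<Rightarrow> 'v" +
  fixes ip :: "'v \<Rightarrow> 'v \<Rightarrow> 'k"
  assumes sm_of_real: "sm (of_real r) x = r *\<^sub>R x"
    and ip_add_left: "ip (x + y) z = ip x z + ip y z"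
    and ip_sm_left: "ip (sm c x) y = c * ip x y"
    and ip_commute: "ip y x = conj (ip x y)"
    and ip_self: "ip x x = of_real (x \<bullet> x)"

lemma hilbert_space_real:
  "hilbert_space (scaleR :: real \<Rightarrow> 'v \<Rightarrow> 'v::{real_inner, complete_space}) inner"
  by unfold_locales (simp_all add: conj_real_def inner_commute algebra_simps)

lemma hilbert_space_complex: "hilbert_space (*) (\<lambda>x y::complex. x * cnj y)"
  by unfold_locales
    (simp_all add: conj_complex_def scaleR_conv_of_real algebra_simps complex_norm_square
      flip: power2_norm_eq_inner del: of_real_power)

definition bounded_op :: "('k::rc_field \<Rightarrow> 'v::real_inner \<Rightarrow> 'v) \<Rightarrow> ('v \<Rightarrow> 'v) \<Rightarrow> bool" where
  "bounded_op sm A \<longleftrightarrow> bounded_linear A \<and> (\<forall>c x. A (sm c x) = sm c (A x))"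

definition nullspace :: "('v::real_inner \<Rightarrow> 'v) \<Rightarrow> 'v set" where
  "nullspace A = {x. A x = 0}"

text \<open>
  The definite descriptions below are meaningful in a Hilbert space: every bounded operator has
  a unique adjoint, a unique modulus and a unique isometric part.
\<close>

definition adj :: "('v::real_inner \<Rightarrow> 'v \<Rightarrow> 'k::rc_field) \<Rightarrow> ('v \<Rightarrow> 'v) \<Rightarrow> 'v \<Rightarrow> 'v" where
  "adj ip A = (THE B. \<forall>x y. ip (A x) y = ip x (B y))"

definition pos_op ::
    "('k::rc_field \<Rightarrow> 'v::real_inner \<Rightarrow> 'v) \<Rightarrow> ('v \<Rightarrow> 'v \<Rightarrow> 'k) \<Rightarrow> ('v \<Rightarrow> 'v) \<Rightarrow> bool" where
  "pos_op sm ip B \<longleftrightarrow>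
     bounded_op sm B \<and> adj ip B = B \<and> (\<forall>x. ip (B x) x \<in> \<real>\<^sub>\<ge>\<^sub>0)"

definition orth_projection ::
    "('k::rc_field \<Rightarrow> 'v::real_inner \<Rightarrow> 'v) \<Rightarrow> ('v \<Rightarrow> 'v \<Rightarrow> 'k) \<Rightarrow> ('v \<Rightarrow> 'v) \<Rightarrow> bool" where
  "orth_projection sm ip P \<longleftrightarrow> bounded_op sm P \<and> P \<circ> P = P \<and> adj ip P = P"

definition partial_isometry ::
    "('k::rc_field \<Rightarrow> 'v::real_inner \<Rightarrow> 'v) \<Rightarrow> ('v \<Rightarrow> 'v \<Rightarrow> 'k) \<Rightarrow> ('v \<Rightarrow> 'v) \<Rightarrow> bool" where
  "partial_isometry sm ip V \<longleftrightarrow>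
     bounded_op sm V \<and>
     (\<forall>x. (\<forall>z\<in>nullspace V. ip x z = 0) \<longrightarrow> norm (V x) = norm x)"

definition modulus ::
    "('k::rc_field \<Rightarrow> 'v::real_inner \<Rightarrow> 'v) \<Rightarrow> ('v \<Rightarrow> 'v \<Rightarrow> 'k) \<Rightarrow> ('v \<Rightarrow> 'v) \<Rightarrow> 'v \<Rightarrow> 'v" where
  "modulus sm ip C = (THE B. pos_op sm ip B \<and> B \<circ> B = adj ip C \<circ> C)"

definition isometric_part ::
    "('k::rc_field \<Rightarrow> 'v::real_inner \<Rightarrow> 'v) \<Rightarrow> ('v \<Rightarrow> 'v \<Rightarrow> 'k) \<Rightarrow> ('v \<Rightarrow> 'v) \<Rightarrow> 'v \<Rightarrow> 'v" where
  "isometric_part sm ip C =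
     (THE V. partial_isometry sm ip V \<and> nullspace V = nullspace C \<and>
             C = V \<circ> modulus sm ip C)"

definition proj_products ::
    "('k::rc_field \<Rightarrow> 'v::real_inner \<Rightarrow> 'v) \<Rightarrow> ('v \<Rightarrow> 'v \<Rightarrow> 'k) \<Rightarrow> ('v \<Rightarrow> 'v) set" where
  "proj_products sm ip =
     {P \<circ> Q | P Q. orth_projection sm ip P \<and> orth_projection sm ip Q}"

definition proj_product_isometric_parts ::
    "('k::rc_field \<Rightarrow> 'v::real_inner \<Rightarrow> 'v) \<Rightarrow> ('v \<Rightarrow> 'v \<Rightarrow> 'k) \<Rightarrow> ('v \<Rightarrow> 'v) set" where
  "proj_product_isometric_parts sm ip = isometric_part sm ip ` proj_products sm ip"

end

theory Submission
  imports Defs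
begin

text \<open>
  Let \<open>T = P Q\<close> have polar decomposition \<open>T = V M\<close>. Then \<open>T T\<^sup>* T = T T\<close>, that is,
  \<open>V M\<^sup>3 = V M V M\<close>; cancelling \<open>V\<close> and \<open>M\<close>, whose null spaces coincide, gives \<open>V M\<^sup>2 = V\<^sup>2 M\<close>, and
  taking adjoints turns this into \<open>V\<^sup>2 V\<^sup>* = V M V\<^sup>* \<ge> 0\<close>, an operator with the null space of \<open>V\<^sup>*\<close>.
  Conversely, if \<open>A = V\<^sup>2 V\<^sup>* \<ge> 0\<close>, then \<open>V\<^sup>2 V\<^sup>* = V V\<^sup>* V\<^sup>*\<close> yields \<open>V\<^sup>2 = (V V\<^sup>*) (V\<^sup>* V)\<close>, a product of
  two projections, whose modulus is \<open>V\<^sup>* A V\<close> and whose isometric part is \<open>V\<close> itself.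
\<close>

section \<open>Orthogonal projections and adjoints in real Hilbert spaces\<close>

lemma orthogonal_closure:
  fixes w :: "'v::real_inner"
  assumes "\<And>s. s \<in> S \<Longrightarrow> w \<bullet> s = 0" "x \<in> closure S"
  shows "w \<bullet> x = 0"
proof -
  have "closure S \<subseteq> {s. w \<bullet> s = 0}"
    by (rule closure_minimal) (use assms closed_hyperplane in auto)
  then show ?thesis using assms(2) by auto
qed

text \<open>Projection theorem: a minimizing sequence in \<open>S\<close> is Cauchy by the
  parallelogram identity, and its limit \<open>z\<close> lies in the closure. Closedness is not
  assumed, so that ranges of operators are covered; testing against \<open>S\<close> suffices
  because orthogonality extends to the closure.\<close>

lemma orthogonal_decomposition:
  fixes y :: "'v::{real_inner, complete_space}"
  assumes S: "subspace S"
  obtains z where "z \<in> closure S" "\<And>s. s \<in> S \<Longrightarrow> (y - z) \<bullet> s = 0"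
proof -
  define d where "d = infdist y S"
  have ne: "S \<noteq> {}" using subspace_0[OF S] by auto
  have d0: "d \<ge> 0" unfolding d_def by (rule infdist_nonneg)
  have low: "d \<le> norm (y - s)" if "s \<in> S" for s
    using infdist_le[OF that, of y] by (simp add: d_def dist_norm)
  have low2: "d\<^sup>2 \<le> (norm (y - s))\<^sup>2" if "s \<in> S" for s
    using low[OF that] d0 by (simp add: power_mono)
  have "\<exists>s\<in>S. norm (y - s) < d + inverse (real (Suc n))" for n
  proof -
    have "d < d + inverse (real (Suc n))" by simp
    then have "(INF a\<in>S. dist y a) < d + inverse (real (Suc n))"
      using ne by (simp add: d_def infdist_notempty)
    then show ?thesis
      by (subst (asm) cINF_less_iff) (use ne in \<open>auto simp: dist_norm intro!: bdd_belowI[of _ 0]\<close>)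
  qed
  then obtain Z where ZS: "\<And>n. Z n \<in> S" and Z: "\<And>n. norm (y - Z n) < d + inverse (real (Suc n))"
    by metis
  have lim: "(\<lambda>n. norm (y - Z n)) \<longlonglongrightarrow> d"
  proof (rule tendsto_sandwich[of "\<lambda>_. d"])
    show "(\<lambda>n. d + inverse (real (Suc n))) \<longlonglongrightarrow> d"
      using tendsto_add[OF tendsto_const LIMSEQ_inverse_real_of_nat, of d] by simp
  qed (use low ZS Z in \<open>auto intro!: always_eventually simp: less_imp_le\<close>)
  then have lim2: "(\<lambda>n. (norm (y - Z n))\<^sup>2) \<longlonglongrightarrow> d\<^sup>2" by (rule tendsto_power)
  have "Cauchy Z"
  proof (rule metric_CauchyI)
    fix e :: real assume e: "e > 0"
    then have "d\<^sup>2 < d\<^sup>2 + e\<^sup>2 / 4" by simp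
    from order_tendstoD(2)[OF lim2 this]
    obtain N where N: "\<And>n. n \<ge> N \<Longrightarrow> (norm (y - Z n))\<^sup>2 < d\<^sup>2 + e\<^sup>2 / 4"
      unfolding eventually_sequentially by auto
    show "\<exists>N. \<forall>m\<ge>N. \<forall>n\<ge>N. dist (Z m) (Z n) < e"
    proof (intro exI allI impI)
      fix m n assume mn: "N \<le> m" "N \<le> n"
      \<comment> \<open>The midpoint of two members of the sequence is again in \<open>S\<close>, so
        its distance to \<open>y\<close> is at least \<open>d\<close>; this bounds the negative term
        of the parallelogram identity.\<close>
      have "(1/2) *\<^sub>R (Z m + Z n) \<in> S"
        by (intro subspace_scale subspace_add S ZS)
      from low2[OF this] have l: "d\<^sup>2 \<le> (norm (y - (1/2) *\<^sub>R (Z m + Z n)))\<^sup>2" .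
      have "(norm (Z m - Z n))\<^sup>2 = 2 * (norm (y - Z m))\<^sup>2 + 2 * (norm (y - Z n))\<^sup>2
          - 4 * (norm (y - (1/2) *\<^sub>R (Z m + Z n)))\<^sup>2"
        unfolding power2_norm_eq_inner by (simp add: algebra_simps inner_commute)
      also have "\<dots> < e\<^sup>2" using N[OF mn(1)] N[OF mn(2)] l by linarith
      finally show "dist (Z m) (Z n) < e"
        using e by (simp add: dist_norm power2_less_imp_less)
    qed
  qed
  then obtain z where z: "Z \<longlonglongrightarrow> z"
    by (auto simp: Cauchy_convergent_iff convergent_def)
  have zc: "z \<in> closure S" using z ZS closure_sequential by blast
  have nz: "norm (y - z) = d"
    using LIMSEQ_unique[OF tendsto_norm[OF tendsto_diff[OF tendsto_const z]] lim] .
  have "(y - z) \<bullet> s = 0" if s: "s \<in> S" for s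
  proof (cases "s = 0")
    case False
    \<comment> \<open>This \<open>t\<close> minimizes the quadratic t -> norm of (y - z) - t s,
      squared. Moving by \<open>t *\<^sub>R s\<close> would beat the minimal distance unless the
      inner product vanishes.\<close>
    define t where "t = ((y - z) \<bullet> s) / (s \<bullet> s)"
    have "(\<lambda>n. norm (y - (Z n + t *\<^sub>R s))) \<longlonglongrightarrow> norm (y - (z + t *\<^sub>R s))"
      by (intro tendsto_intros z)
    moreover have "d \<le> norm (y - (Z n + t *\<^sub>R s))" for n
      by (intro low subspace_add subspace_scale S ZS s)
    ultimately have "d \<le> norm (y - (z + t *\<^sub>R s))" by (simp add: LIMSEQ_le_const)
    then have "(norm (y - z))\<^sup>2 \<le> (norm ((y - z) - t *\<^sub>R s))\<^sup>2"
      using d0 nz by (simp add: power_mono diff_diff_eq)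
    also have "\<dots> = (norm (y - z))\<^sup>2 - 2 * t * ((y - z) \<bullet> s) + t\<^sup>2 * (s \<bullet> s)"
      unfolding power2_norm_eq_inner by (simp add: algebra_simps inner_commute power2_eq_square)
    also have "\<dots> = (norm (y - z))\<^sup>2 - ((y - z) \<bullet> s)\<^sup>2 / (s \<bullet> s)"
      using False by (simp add: t_def field_simps power2_eq_square)
    finally have "((y - z) \<bullet> s)\<^sup>2 / (s \<bullet> s) \<le> 0" by simp
    moreover have "s \<bullet> s > 0" using False by simp
    ultimately show ?thesis by (simp add: divide_le_0_iff)
  qed simp
  with zc that show ?thesis by blast
qed

text \<open>The double orthogonal complement of a subspace lies in its closure: the component
  \<open>y - z\<close> is orthogonal to \<open>S\<close>, hence to \<open>z\<close> by continuity
  and to \<open>y\<close> by hypothesis, hence to itself.\<close>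

lemma mem_closure_subspaceI:
  fixes y :: "'v::{real_inner, complete_space}"
  assumes S: "subspace S"
    and y: "\<And>z. (\<And>s. s \<in> S \<Longrightarrow> z \<bullet> s = 0) \<Longrightarrow> z \<bullet> y = 0"
  shows "y \<in> closure S"
proof -
  obtain z where z: "z \<in> closure S" "\<And>s. s \<in> S \<Longrightarrow> (y - z) \<bullet> s = 0"
    using orthogonal_decomposition[OF S] by blast
  have "(y - z) \<bullet> y = 0" "(y - z) \<bullet> z = 0"
    using y[OF z(2)] orthogonal_closure[OF z(2) z(1)] by auto
  then have "(y - z) \<bullet> (y - z) = 0" by (simp add: inner_diff_right)
  then show ?thesis using z(1) by simp
qed

text \<open>The representing vector is a multiple of the component \<open>w\<close> of some
  \<open>x0\<close> orthogonal to the kernel. Every \<open>x\<close> differs from a multiple of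
  \<open>w\<close> by a kernel element, which fixes the factor.\<close>

lemma riesz_representation:
  fixes f :: "'v::{real_inner, complete_space} \<Rightarrow> real"
  assumes f: "bounded_linear f"
  obtains b where "\<And>x. f x = x \<bullet> b"
proof (cases "\<forall>x. f x = 0")
  case True
  then show ?thesis using that[of 0] by simp
next
  case False
  interpret f: bounded_linear f by fact
  obtain x0 where x0: "f x0 \<noteq> 0" using False by auto
  let ?N = "{x. f x = 0}"
  have N: "subspace ?N" by (simp add: subspace_def f.zero f.add f.scaleR)
  have "closed ?N"
    by (intro closed_Collect_eq continuous_intros linear_continuous_on f)
  then have "closure ?N = ?N" by (rule closure_closed)
  then obtain z where z: "f z = 0" "\<And>s. f s = 0 \<Longrightarrow> (x0 - z) \<bullet> s = 0"
    using orthogonal_decomposition[OF N, of x0] by (metis (mono_tags, lifting) mem_Collect_eq)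
  define w where "w = x0 - z"
  have fw: "f w \<noteq> 0" using x0 z by (simp add: w_def f.diff)
  then have w0: "w \<noteq> 0" by (auto simp: f.zero)
  have "f x = x \<bullet> ((f w / (w \<bullet> w)) *\<^sub>R w)" for x
  proof -
    have "f (x - (f x / f w) *\<^sub>R w) = 0" using fw by (simp add: f.diff f.scaleR)
    then have "w \<bullet> (x - (f x / f w) *\<^sub>R w) = 0" using z(2) unfolding w_def by blast
    then have "w \<bullet> x = f x / f w * (w \<bullet> w)" by (simp add: inner_diff_right)
    moreover have "w \<bullet> w \<noteq> 0" using w0 by simp
    ultimately have "f x = f w / (w \<bullet> w) * (w \<bullet> x)" using fw by simp
    then show ?thesis by (simp add: inner_commute[of x w])
  qed
  then show ?thesis by (rule that)
qed

lemma eq_0_iff_inner: "x = 0 \<longleftrightarrow> (\<forall>y. x \<bullet> y = 0)" for x :: "'v::real_inner"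
  by (metis inner_eq_zero_iff inner_zero_left)

lemma eq_iff_inner: "x = y \<longleftrightarrow> (\<forall>z. x \<bullet> z = y \<bullet> z)" for x y :: "'v::real_inner"
  using eq_0_iff_inner[of "x - y"] by (simp add: inner_diff_left)

text \<open>Riesz representation, applied for each \<open>y\<close> to the functional x -> A x . y,
  gives \<open>B\<close> pointwise; nondegeneracy makes it linear, and Cauchy-Schwarz on A (B y) . y
  bounds it.\<close>

lemma adjoint_exists:
  fixes A :: "'v::{real_inner, complete_space} \<Rightarrow> 'w::real_inner"
  assumes A: "bounded_linear A"
  obtains B where "bounded_linear B" "\<And>x y. A x \<bullet> y = x \<bullet> B y"
proof -
  interpret A: bounded_linear A by fact
  have "\<exists>b. \<forall>x. A x \<bullet> y = x \<bullet> b" for y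
    by (rule riesz_representation[OF bounded_linear_compose[OF bounded_linear_inner_left A]]) blast
  then obtain B where B: "\<And>x y. A x \<bullet> y = x \<bullet> B y" by metis
  obtain K where K: "K > 0" "\<And>x. norm (A x) \<le> norm x * K" using A.pos_bounded by blast
  have "bounded_linear B"
  proof (rule bounded_linear_intro)
    show "B (x + y) = B x + B y" for x y
      by (subst eq_iff_inner) (metis B inner_add_right inner_commute)
    show "B (r *\<^sub>R x) = r *\<^sub>R B x" for r x
      by (subst eq_iff_inner) (metis B inner_scaleR_right inner_commute)
    show "norm (B y) \<le> norm y * K" for y
    proof (cases "B y = 0")
      case False
      have "norm (B y) * norm (B y) = A (B y) \<bullet> y"
        by (simp add: B flip: power2_norm_eq_inner power2_eq_square)
      also have "\<dots> \<le> norm (A (B y)) * norm y" by (rule norm_cauchy_schwarz)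
      also have "\<dots> \<le> (norm (B y) * K) * norm y" by (intro mult_right_mono K) simp
      finally show ?thesis using False by (simp add: mult.assoc mult.commute)
    qed (use K in simp)
  qed
  then show ?thesis using B that by blast
qed

lemma contraction_adjoint:
  fixes T :: "'v::real_inner \<Rightarrow> 'w::real_inner"
  assumes T: "\<And>x. norm (T x) \<le> norm x" and adj: "\<And>x y. T x \<bullet> y = x \<bullet> S y"
  shows "norm (S y) \<le> norm y"
proof (cases "S y = 0")
  case False
  have "norm (S y) * norm (S y) = T (S y) \<bullet> y"
    by (simp add: adj flip: power2_norm_eq_inner power2_eq_square)
  also have "\<dots> \<le> norm (T (S y)) * norm y" by (rule norm_cauchy_schwarz)
  also have "\<dots> \<le> norm (S y) * norm y" by (intro mult_right_mono T) simp
  finally show ?thesis using False by simp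
qed simp

section \<open>Square roots of positive contractions\<close>

text \<open>The iteration \<open>sqrt_iter\<close> for \<open>R = 1\<close>, read as multiples of
  the identity. Its increments bound those of \<open>sqrt_iter R\<close> for every linear
  contraction \<open>R\<close>.\<close>

primrec sqrt_majorant :: "nat \<Rightarrow> real" where
  "sqrt_majorant 0 = 0"
| "sqrt_majorant (Suc n) = (1 + (sqrt_majorant n)\<^sup>2) / 2"

lemma sqrt_majorant_bounds: "0 \<le> sqrt_majorant n \<and> sqrt_majorant n \<le> 1"
proof (induction n)
  case (Suc n)
  then have "(sqrt_majorant n)\<^sup>2 \<le> 1" by (simp add: power_le_one)
  then show ?case by simp
qed simp

lemma sqrt_majorant_mono: "incseq sqrt_majorant"
proof (rule incseq_SucI)
  show "sqrt_majorant n \<le> sqrt_majorant (Suc n)" for n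
  proof -
    have "0 \<le> (1 - sqrt_majorant n)\<^sup>2" by simp
    then show ?thesis by (simp add: power2_eq_square algebra_simps)
  qed
qed

text \<open>The iterates are polynomials in \<open>R\<close>, so symmetry of \<open>R\<close> and
  commutation with \<open>R\<close> pass to them and then to their limit.\<close>

primrec sqrt_iter :: "('v::real_vector \<Rightarrow> 'v) \<Rightarrow> nat \<Rightarrow> 'v \<Rightarrow> 'v" where
  "sqrt_iter R 0 = (\<lambda>_. 0)"
| "sqrt_iter R (Suc n) = (\<lambda>x. (1/2) *\<^sub>R (R x + sqrt_iter R n (sqrt_iter R n x)))"

lemma bounded_linear_sqrt_iter:
  assumes "bounded_linear R"
  shows "bounded_linear (sqrt_iter R n)"
  by (induction n)
    (auto intro!: bounded_linear_const_scaleR bounded_linear_add assms bounded_linear_zero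
      intro: bounded_linear_compose)

lemma norm_sqrt_iter:
  assumes R: "\<And>x. norm (R x) \<le> norm x"
  shows "norm (sqrt_iter R n x) \<le> sqrt_majorant n * norm x"
proof (induction n arbitrary: x)
  case (Suc n)
  have "norm (sqrt_iter R n (sqrt_iter R n x)) \<le> sqrt_majorant n * (sqrt_majorant n * norm x)"
    using Suc.IH sqrt_majorant_bounds by (meson mult_left_mono order_trans)
  then have "norm (R x + sqrt_iter R n (sqrt_iter R n x)) \<le> norm x + (sqrt_majorant n)\<^sup>2 * norm x"
    using R[of x] by (intro norm_triangle_le) (simp add: power2_eq_square)
  moreover have "sqrt_majorant (Suc n) * norm x = (norm x + (sqrt_majorant n)\<^sup>2 * norm x) / 2"
    by (simp add: field_simps)
  ultimately show ?case by (simp del: scaleR_right_distrib scaleR_add_right sqrt_majorant.simps)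
qed simp

text \<open>With Y and Z consecutive iterates, Z Z - Y Y = Z (Z - Y) + (Z - Y) Y holds without
  commutativity. Bounding each factor by its scalar counterpart reproduces the difference of the
  scalar squares.\<close>

lemma norm_sqrt_iter_Suc_diff:
  assumes R: "bounded_linear R" "\<And>x. norm (R x) \<le> norm x"
  shows "norm (sqrt_iter R (Suc n) x - sqrt_iter R n x)
    \<le> (sqrt_majorant (Suc n) - sqrt_majorant n) * norm x"
proof (induction n arbitrary: x)
  case 0
  show ?case using R(2)[of x] by simp
next
  case (Suc n)
  let ?Y = "sqrt_iter R" and ?m = sqrt_majorant
  interpret Y: bounded_linear "?Y k" for k by (rule bounded_linear_sqrt_iter[OF R(1)])
  have inc: "?m n \<le> ?m (Suc n)" using sqrt_majorant_mono by (simp add: incseq_Suc_iff)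
  have "?Y (Suc (Suc n)) x - ?Y (Suc n) x
      = (1/2) *\<^sub>R (?Y (Suc n) (?Y (Suc n) x) - ?Y n (?Y n x))"
    unfolding sqrt_iter.simps(2)[of R "Suc n"] sqrt_iter.simps(2)[of R n, THEN fun_cong, of x]
    by (simp only: scaleR_right_diff_distrib[symmetric] add_diff_cancel_left)
  also have "?Y (Suc n) (?Y (Suc n) x) - ?Y n (?Y n x)
      = ?Y (Suc n) (?Y (Suc n) x - ?Y n x) + (?Y (Suc n) (?Y n x) - ?Y n (?Y n x))"
    by (simp only: Y.diff) simp
  finally have eq: "?Y (Suc (Suc n)) x - ?Y (Suc n) x = (1/2) *\<^sub>R
    (?Y (Suc n) (?Y (Suc n) x - ?Y n x) + (?Y (Suc n) (?Y n x) - ?Y n (?Y n x)))" .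
  have "norm (?Y (Suc n) (?Y (Suc n) x - ?Y n x)) \<le> ?m (Suc n) * norm (?Y (Suc n) x - ?Y n x)"
    by (rule norm_sqrt_iter[OF R(2)])
  also have "\<dots> \<le> ?m (Suc n) * ((?m (Suc n) - ?m n) * norm x)"
    by (intro mult_left_mono Suc.IH) (use sqrt_majorant_bounds in blast)
  finally have 1: "norm (?Y (Suc n) (?Y (Suc n) x - ?Y n x)) \<le> ?m (Suc n) * ((?m (Suc n) - ?m n) * norm x)" .
  have "norm (?Y (Suc n) (?Y n x) - ?Y n (?Y n x)) \<le> (?m (Suc n) - ?m n) * norm (?Y n x)"
    by (rule Suc.IH)
  also have "\<dots> \<le> (?m (Suc n) - ?m n) * (?m n * norm x)"
    by (intro mult_left_mono norm_sqrt_iter[OF R(2)]) (use inc in simp)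
  finally have 2: "norm (?Y (Suc n) (?Y n x) - ?Y n (?Y n x)) \<le> (?m (Suc n) - ?m n) * (?m n * norm x)" .
  have "norm (?Y (Suc (Suc n)) x - ?Y (Suc n) x) \<le>
     (1/2) * (?m (Suc n) * ((?m (Suc n) - ?m n) * norm x) + (?m (Suc n) - ?m n) * (?m n * norm x))"
    unfolding eq using norm_triangle_mono[OF 1 2] by simp
  also have "\<dots> = (?m (Suc (Suc n)) - ?m (Suc n)) * norm x"
    unfolding sqrt_majorant.simps(2)[of "Suc n"]
    by (simp only: sqrt_majorant.simps(2)[of n]) (simp add: power2_eq_square field_simps)
  finally show ?case .
qed

lemma norm_sqrt_iter_diff:
  assumes R: "bounded_linear R" "\<And>x. norm (R x) \<le> norm x" and "n \<le> m"
  shows "norm (sqrt_iter R m x - sqrt_iter R n x) \<le> (sqrt_majorant m - sqrt_majorant n) * norm x"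
  using \<open>n \<le> m\<close>
proof (induction m rule: dec_induct)
  case (step m)
  have "sqrt_iter R (Suc m) x - sqrt_iter R n x =
     (sqrt_iter R (Suc m) x - sqrt_iter R m x) + (sqrt_iter R m x - sqrt_iter R n x)"
    by simp
  also have "norm \<dots> \<le> (sqrt_majorant (Suc m) - sqrt_majorant m) * norm x
      + (sqrt_majorant m - sqrt_majorant n) * norm x"
    by (intro norm_triangle_mono norm_sqrt_iter_Suc_diff R step.IH)
  finally show ?case by (simp add: left_diff_distrib del: sqrt_iter.simps sqrt_majorant.simps)
qed simp

lemma convergent_sqrt_iter:
  fixes R :: "'v::{real_normed_vector, complete_space} \<Rightarrow> 'v"
  assumes R: "bounded_linear R" "\<And>x. norm (R x) \<le> norm x"
  shows "convergent (\<lambda>n. sqrt_iter R n x)"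
proof -
  have "convergent sqrt_majorant"
    by (rule incseq_convergent[OF sqrt_majorant_mono, of 1])
      (use sqrt_majorant_bounds in \<open>auto simp: convergent_def\<close>)
  then have "Cauchy sqrt_majorant" by (simp add: Cauchy_convergent_iff)
  then have c: "Cauchy (\<lambda>n. sqrt_majorant n * norm x)"
    by (simp add: Cauchy_convergent_iff convergent_mult convergent_const)
  have "Cauchy (\<lambda>n. sqrt_iter R n x)"
  proof (rule metric_CauchyI)
    fix e :: real assume "e > 0"
    from metric_CauchyD[OF c this] obtain N where
      N: "\<And>m n. m \<ge> N \<Longrightarrow> n \<ge> N \<Longrightarrow> dist (sqrt_majorant m * norm x) (sqrt_majorant n * norm x) < e"
      by blast
    have *: "dist (sqrt_iter R m x) (sqrt_iter R n x) < e" if "m \<ge> N" "n \<ge> N" "n \<le> m" for m n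
      using norm_sqrt_iter_diff[OF R that(3), of x] N[OF that(1,2)]
      by (simp add: dist_norm left_diff_distrib)
    then show "\<exists>N. \<forall>m\<ge>N. \<forall>n\<ge>N. dist (sqrt_iter R m x) (sqrt_iter R n x) < e"
      by (metis dist_commute nle_le)
  qed
  then show ?thesis by (simp add: Cauchy_convergent_iff)
qed

text \<open>
  The fixed point \<open>L\<close> of \<open>Y \<mapsto> (R + Y\<^sup>2) / 2\<close> satisfies \<open>(1 - L)\<^sup>2 = 1 - R\<close>. The iteration
  converges in operator norm because it is dominated by the scalar one for \<open>R = 1\<close>.
\<close>

lemma sqrt_fixed_point:
  fixes R :: "'v::{real_inner, complete_space} \<Rightarrow> 'v"
  assumes R: "bounded_linear R" "\<And>x. norm (R x) \<le> norm x" "\<And>x y. R x \<bullet> y = x \<bullet> R y"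
  obtains L where "bounded_linear L" "\<And>x. norm (L x) \<le> norm x" "\<And>x y. L x \<bullet> y = x \<bullet> L y"
    "\<And>x. 2 *\<^sub>R L x = R x + L (L x)"
    "\<And>C x. bounded_linear C \<Longrightarrow> (\<And>x. C (R x) = R (C x)) \<Longrightarrow> C (L x) = L (C x)"
proof -
  let ?Y = "sqrt_iter R"
  interpret Y: bounded_linear "?Y k" for k by (rule bounded_linear_sqrt_iter[OF R(1)])
  define L where "L x = lim (\<lambda>n. ?Y n x)" for x
  have L: "(\<lambda>n. ?Y n x) \<longlonglongrightarrow> L x" for x
    using convergent_sqrt_iter[OF R(1,2)] by (simp add: L_def convergent_LIMSEQ_iff)
  have nY: "norm (?Y n x) \<le> norm x" for n x
  proof -
    have "sqrt_majorant n * norm x \<le> 1 * norm x"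
      by (rule mult_right_mono) (use sqrt_majorant_bounds in auto)
    then show ?thesis using norm_sqrt_iter[OF R(2), of n x] by linarith
  qed
  have nL: "norm (L x) \<le> norm x" for x
    by (rule LIMSEQ_le_const2[OF tendsto_norm[OF L]]) (use nY in auto)
  have bL: "bounded_linear L"
  proof (rule bounded_linear_intro)
    show "L (x + y) = L x + L y" for x y
      by (rule LIMSEQ_unique[OF L]) (simp only: Y.add tendsto_add L)
    show "L (r *\<^sub>R x) = r *\<^sub>R L x" for r x
      by (rule LIMSEQ_unique[OF L]) (simp only: Y.scaleR tendsto_scaleR tendsto_const L)
    show "norm (L x) \<le> norm x * 1" for x using nL by simp
  qed
  have "?Y n x \<bullet> y = x \<bullet> ?Y n y" for n x y
    by (induction n arbitrary: x y) (simp_all add: inner_add_left inner_add_right R(3))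
  then have sL: "L x \<bullet> y = x \<bullet> L y" for x y
    by (intro LIMSEQ_unique[OF tendsto_inner[OF L tendsto_const]])
      (simp only: tendsto_inner tendsto_const L)
  \<comment> \<open>Pointwise convergence survives squaring because the iterates are uniformly
    contractive: they send the null sequence \<open>?Y n x - L x\<close> to a null sequence.\<close>
  have YY: "(\<lambda>n. ?Y n (?Y n x)) \<longlonglongrightarrow> L (L x)" for x
  proof -
    have "(\<lambda>n. norm (?Y n x - L x)) \<longlonglongrightarrow> 0"
      using L[of x] by (simp add: LIM_zero tendsto_norm_zero)
    then have "(\<lambda>n. ?Y n (?Y n x - L x)) \<longlonglongrightarrow> 0"
      by (rule Lim_null_comparison[rotated]) (simp add: nY)
    from tendsto_add[OF this L[of "L x"]] show ?thesis by (simp add: Y.diff)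
  qed
  have fp: "2 *\<^sub>R L x = R x + L (L x)" for x
  proof -
    have "(\<lambda>n. 2 *\<^sub>R ?Y (Suc n) x) \<longlonglongrightarrow> 2 *\<^sub>R L x"
      by (intro tendsto_intros LIMSEQ_Suc L)
    moreover have "(\<lambda>n. 2 *\<^sub>R ?Y (Suc n) x) \<longlonglongrightarrow> R x + L (L x)"
      by (simp add: tendsto_add YY)
    ultimately show ?thesis by (rule LIMSEQ_unique)
  qed
  have "C (L x) = L (C x)" if C: "bounded_linear C" "\<And>x. C (R x) = R (C x)" for C x
  proof -
    interpret C: bounded_linear C by fact
    have "C (?Y n x) = ?Y n (C x)" for n x
      by (induction n arbitrary: x) (simp_all add: C.zero C.scaleR C.add C(2))
    then show ?thesis
      using LIMSEQ_unique[OF C.tendsto[OF L] , of x "L (C x)"] L[of "C x"] by simp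
  qed
  with bL nL sL fp that show ?thesis by blast
qed

text \<open>With R = 1 - T' T and its fixed point L, the operator M = 1 - L has square 1 - 2 L + L L
  = 1 - R = T' T. The commutation clause serves two purposes: uniqueness of the root, and linearity
  over the scalar field.\<close>

lemma positive_sqrt_exists:
  fixes T :: "'v::{real_inner, complete_space} \<Rightarrow> 'v"
  assumes T: "bounded_linear T" "\<And>x. norm (T x) \<le> norm x"
    and T': "bounded_linear T'" "\<And>x y. T x \<bullet> y = x \<bullet> T' y"
  obtains M where "bounded_linear M" "\<And>x y. M x \<bullet> y = x \<bullet> M y" "\<And>x. M x \<bullet> x \<ge> 0"
    "\<And>x. M (M x) = T' (T x)"
    "\<And>C x. bounded_linear C \<Longrightarrow> (\<And>x. C (T' (T x)) = T' (T (C x))) \<Longrightarrow> C (M x) = M (C x)"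
proof -
  define R where "R x = x - T' (T x)" for x
  have bTT: "bounded_linear (\<lambda>x. T' (T x))" by (rule bounded_linear_compose[OF T'(1) T(1)])
  have bR: "bounded_linear R"
    unfolding R_def by (rule bounded_linear_sub[OF bounded_linear_ident bTT])
  have sTT: "T' (T x) \<bullet> y = x \<bullet> T' (T y)" for x y
    by (metis T'(2) inner_commute)
  have sR: "R x \<bullet> y = x \<bullet> R y" for x y
    by (simp add: R_def inner_diff_left inner_diff_right sTT)
  \<comment> \<open>The squared norm of \<open>R x\<close> is that of \<open>x\<close>, minus twice
    that of \<open>T x\<close>, plus that of \<open>T' (T x)\<close>; the last is at most that of
    \<open>T x\<close> since the adjoint is a contraction too.\<close>
  have nR: "norm (R x) \<le> norm x" for x
  proof -
    have "norm (T' (T x)) \<le> norm (T x)" by (rule contraction_adjoint[OF T(2) T'(2)])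
    then have "T' (T x) \<bullet> T' (T x) \<le> T x \<bullet> T x"
      by (simp flip: power2_norm_eq_inner add: power_mono)
    moreover have "x \<bullet> T' (T x) = T x \<bullet> T x" by (simp add: T'(2))
    moreover have "T' (T x) \<bullet> T' (T x) \<le> 2 * (T x \<bullet> T x)"
      using calculation(1) inner_ge_zero[of "T x"] by linarith
    ultimately have "R x \<bullet> R x \<le> x \<bullet> x"
      by (simp add: R_def inner_diff_left inner_diff_right inner_commute[of "T' (T x)" x])
    then show ?thesis by (simp add: norm_le)
  qed
  obtain L where L: "bounded_linear L" "\<And>x. norm (L x) \<le> norm x" "\<And>x y. L x \<bullet> y = x \<bullet> L y"
    "\<And>x. 2 *\<^sub>R L x = R x + L (L x)"
    "\<And>C x. bounded_linear C \<Longrightarrow> (\<And>x. C (R x) = R (C x)) \<Longrightarrow> C (L x) = L (C x)"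
    using sqrt_fixed_point[OF bR nR sR] by blast
  interpret L: bounded_linear L by fact
  show ?thesis
  proof (rule that[of "\<lambda>x. x - L x"])
    show "bounded_linear (\<lambda>x. x - L x)" by (rule bounded_linear_sub[OF bounded_linear_ident L(1)])
    show "(x - L x) \<bullet> y = x \<bullet> (y - L y)" for x y
      by (simp add: inner_diff_left inner_diff_right L(3))
    show "0 \<le> (x - L x) \<bullet> x" for x
    proof -
      have "L x \<bullet> x \<le> norm (L x) * norm x" by (rule norm_cauchy_schwarz)
      also have "\<dots> \<le> norm x * norm x" by (rule mult_right_mono) (use L(2) in auto)
      finally show ?thesis
        by (simp add: inner_diff_left flip: power2_eq_square power2_norm_eq_inner)
    qed
    show "x - L x - L (x - L x) = T' (T x)" for x
      using L(4)[of x] by (simp add: L.diff R_def scaleR_2 algebra_simps)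
    show "C (x - L x) = C x - L (C x)"
      if C: "bounded_linear C" "\<And>x. C (T' (T x)) = T' (T (C x))" for C x
    proof -
      interpret C: bounded_linear C by fact
      show ?thesis using L(5)[OF C(1), of x] by (simp add: R_def C.diff C(2))
    qed
  qed
qed

text \<open>Positivity at \<open>y + t *\<^sub>R M y\<close> leaves a quadratic in t without
  constant term that is nonnegative for all t, so its linear coefficient, twice the squared norm of
  \<open>M y\<close>, vanishes.\<close>

lemma positive_op_eq_0I:
  fixes M :: "'v::real_inner \<Rightarrow> 'v"
  assumes M: "linear M" "\<And>x y. M x \<bullet> y = x \<bullet> M y" "\<And>x. M x \<bullet> x \<ge> 0" and y: "M y \<bullet> y = 0"
  shows "M y = 0"
proof -
  interpret M: linear M by fact
  define a where "a = M y \<bullet> M y"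
  define b where "b = M (M y) \<bullet> M y"
  have b0: "b \<ge> 0" unfolding b_def by (rule M(3))
  have "0 \<le> 2 * t * a + t\<^sup>2 * b" for t
  proof -
    have "0 \<le> M (y + t *\<^sub>R M y) \<bullet> (y + t *\<^sub>R M y)" by (rule M(3))
    also have "\<dots> = M y \<bullet> y + 2 * t * a + t\<^sup>2 * b"
      unfolding a_def b_def M.add M.scale
      by (simp add: inner_add_left inner_add_right M(2)[of "M y" y] power2_eq_square algebra_simps)
    finally show ?thesis by (simp add: y)
  qed
  \<comment> \<open>The denominator \<open>b + 1\<close> instead of \<open>b\<close> also covers the
    case \<open>b = 0\<close>.\<close>
  from this[of "- (a / (b + 1))"] have "2 * (a / (b + 1)) * a \<le> (a / (b + 1))\<^sup>2 * b" by simp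
  also have "\<dots> \<le> (a / (b + 1))\<^sup>2 * (b + 1)" by (intro mult_left_mono) auto
  also have "\<dots> = a / (b + 1) * a" using b0 by (simp add: power2_eq_square)
  finally have "a * a / (b + 1) \<le> 0" by simp
  then have "a * a \<le> 0" using b0 by (simp add: divide_le_0_iff)
  then have "a = 0" by (auto simp: mult_le_0_iff)
  then show ?thesis by (simp add: a_def)
qed

text \<open>Both roots are compared with the constructed root M. A root D commutes with D D = T' T,
  hence with M, so (D + M) (D - M) = 0. On y = D x - M x two nonnegative forms then add up to zero,
  so D y = M y = 0, and symmetry gives y . y = 0.\<close>

lemma positive_sqrt_unique:
  fixes T :: "'v::{real_inner, complete_space} \<Rightarrow> 'v"
  assumes T: "bounded_linear T" "\<And>x. norm (T x) \<le> norm x"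
    and T': "bounded_linear T'" "\<And>x y. T x \<bullet> y = x \<bullet> T' y"
    and B: "bounded_linear B" "\<And>x y. B x \<bullet> y = x \<bullet> B y" "\<And>x. B x \<bullet> x \<ge> 0" "\<And>x. B (B x) = T' (T x)"
    and C: "bounded_linear C" "\<And>x y. C x \<bullet> y = x \<bullet> C y" "\<And>x. C x \<bullet> x \<ge> 0" "\<And>x. C (C x) = T' (T x)"
  shows "B = C"
proof -
  obtain M where M: "bounded_linear M" "\<And>x y. M x \<bullet> y = x \<bullet> M y" "\<And>x. M x \<bullet> x \<ge> 0"
    "\<And>x. M (M x) = T' (T x)"
    "\<And>C x. bounded_linear C \<Longrightarrow> (\<And>x. C (T' (T x)) = T' (T (C x))) \<Longrightarrow> C (M x) = M (C x)"
    using positive_sqrt_exists[OF T T'] by blast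
  have "D = M" if D: "bounded_linear D" "\<And>x y. D x \<bullet> y = x \<bullet> D y" "\<And>x. D x \<bullet> x \<ge> 0"
      "\<And>x. D (D x) = T' (T x)" for D
  proof
    fix x
    interpret M: bounded_linear M by fact
    interpret D: bounded_linear D by fact
    have com: "D (M x) = M (D x)" for x
      by (rule M(5)[OF D(1)]) (simp flip: D(4))
    define y where "y = D x - M x"
    have "D y + M y = 0"
      by (simp add: y_def D.diff M.diff D(4) M(4) com)
    then have "D y \<bullet> y + M y \<bullet> y = 0" by (metis inner_add_left inner_zero_left)
    then have "D y \<bullet> y = 0" "M y \<bullet> y = 0" using D(3)[of y] M(3)[of y] by linarith+
    then have "D y = 0" "M y = 0"
      using positive_op_eq_0I[OF D.linear_axioms D(2,3)] positive_op_eq_0I[OF M.linear_axioms M(2,3)]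
      by blast+
    then have "D x \<bullet> y = 0" "M x \<bullet> y = 0" by (simp_all add: D(2) M(2))
    then have "(D x - M x) \<bullet> y = 0" by (simp add: inner_diff_left)
    then have "y \<bullet> y = 0" by (simp flip: y_def)
    then show "D x = M x" by (simp add: y_def)
  qed
  from this[OF B] this[OF C] show ?thesis by simp
qed

section \<open>Polar decomposition\<close>

lemma selfadjoint_null_closure_range:
  fixes B :: "'v::real_inner \<Rightarrow> 'v"
  assumes B: "\<And>x y. B x \<bullet> y = x \<bullet> B y" and z: "z \<in> closure (range B)" and w: "B w = 0"
  shows "w \<bullet> z = 0"
  by (rule orthogonal_closure[OF _ z]) (use w B in \<open>metis inner_zero_left rangeE\<close>)

text \<open>
  The value of \<open>V\<close> at \<open>y\<close> is the limit of \<open>T (X n)\<close> for any sequence such that \<open>B (X n)\<close> converges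
  to the projection of \<open>y\<close> onto the closure of the range of \<open>B\<close>; a point \<open>z\<close> of that closure is
  the projection iff \<open>B z = B y\<close>.
\<close>

lemma polar_extension:
  fixes B T :: "'v::{real_inner, complete_space} \<Rightarrow> 'v"
  assumes B: "bounded_linear B" "\<And>x y. B x \<bullet> y = x \<bullet> B y"
    and T: "bounded_linear T" and BT: "\<And>x. norm (T x) = norm (B x)"
  obtains V where "bounded_linear V" "\<And>x. V (B x) = T x" "\<And>x. V x = 0 \<longleftrightarrow> T x = 0"
    "\<And>x. (\<And>z. V z = 0 \<Longrightarrow> x \<bullet> z = 0) \<Longrightarrow> norm (V x) = norm x"
    "\<And>C x. bounded_linear C \<Longrightarrow> (\<And>x. C (B x) = B (C x)) \<Longrightarrow> (\<And>x. C (T x) = T (C x)) \<Longrightarrow> C (V x) = V (C x)"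
proof -
  interpret B: bounded_linear B by fact
  interpret T: bounded_linear T by fact
  define G where "G y w \<longleftrightarrow> (\<exists>X z. (\<lambda>n. B (X n)) \<longlonglongrightarrow> z \<and> (\<lambda>n. T (X n)) \<longlonglongrightarrow> w \<and> B z = B y)" for y w
  have G_norm: "\<exists>z\<in>closure (range B). B z = B y \<and> norm w = norm z \<and> z \<bullet> (y - z) = 0" if "G y w" for y w
  proof -
    from that obtain X z where X: "(\<lambda>n. B (X n)) \<longlonglongrightarrow> z" "(\<lambda>n. T (X n)) \<longlonglongrightarrow> w" "B z = B y"
      unfolding G_def by blast
    have z: "z \<in> closure (range B)" unfolding closure_sequential by (rule exI[of _ "\<lambda>n. B (X n)"]) (simp add: X(1))
    have "norm w = norm z"
      using LIMSEQ_unique[OF tendsto_norm[OF X(2)]] tendsto_norm[OF X(1)] by (simp add: BT)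
    moreover have "z \<bullet> (y - z) = 0"
      using selfadjoint_null_closure_range[OF B(2) z, of "y - z"] X(3) by (simp add: B.diff inner_commute)
    ultimately show ?thesis using z X(3) by blast
  qed
  have G_le: "norm w \<le> norm y" if "G y w" for y w
  proof -
    from G_norm[OF that] obtain z where z: "norm w = norm z" "z \<bullet> (y - z) = 0" by blast
    have "z \<bullet> z \<le> y \<bullet> y"
    proof -
      have "y \<bullet> y = z \<bullet> z + 2 * (z \<bullet> (y - z)) + (y - z) \<bullet> (y - z)"
        by (simp add: inner_diff_left inner_diff_right inner_commute)
      then show ?thesis using z(2) inner_ge_zero[of "y - z"] by linarith
    qed
    then show ?thesis using z(1) by (simp add: norm_le)
  qed
  have G_ex: "\<exists>w. G y w" for y
  proof -
    have "subspace (range B)" by (intro linear_subspace_image B.linear_axioms subspace_UNIV)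
    then obtain z where z: "z \<in> closure (range B)" "\<And>s. s \<in> range B \<Longrightarrow> (y - z) \<bullet> s = 0"
      using orthogonal_decomposition by blast
    then obtain Y where "\<forall>n. Y n \<in> range B" and Y: "Y \<longlonglongrightarrow> z"
      unfolding closure_sequential by blast
    then have "\<forall>n. \<exists>x. Y n = B x" by blast
    then obtain X where X: "\<And>n. Y n = B (X n)" by metis
    have lim: "(\<lambda>n. B (X n)) \<longlonglongrightarrow> z" using Y by (simp flip: X)
    have "dist (T (X m)) (T (X n)) = dist (B (X m)) (B (X n))" for m n
      by (simp add: dist_norm BT flip: T.diff B.diff)
    moreover have "Cauchy (\<lambda>n. B (X n))" using lim by (rule LIMSEQ_imp_Cauchy)
    ultimately have "Cauchy (\<lambda>n. T (X n))" by (simp add: Cauchy_def)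
    then obtain w where "(\<lambda>n. T (X n)) \<longlonglongrightarrow> w" by (auto simp: Cauchy_convergent_iff convergent_def)
    \<comment> \<open>Testing the orthogonality of \<open>y - z\<close> to the range of
      \<open>B\<close> with \<open>B (B (y - z))\<close> gives the squared norm of
      \<open>B (y - z)\<close>.\<close>
    moreover have "B (y - z) \<bullet> B (y - z) = 0" using z(2)[of "B (B (y - z))"] by (simp add: B(2))
    then have "B z = B y" by (simp add: B.diff)
    ultimately show ?thesis unfolding G_def using lim by blast
  qed
  have G_add: "G (y + y') (w + w')" if "G y w" "G y' w'" for y w y' w'
  proof -
    from that obtain X z X' z' where
      "(\<lambda>n. B (X n)) \<longlonglongrightarrow> z" "(\<lambda>n. T (X n)) \<longlonglongrightarrow> w" "B z = B y"
      "(\<lambda>n. B (X' n)) \<longlonglongrightarrow> z'" "(\<lambda>n. T (X' n)) \<longlonglongrightarrow> w'" "B z' = B y'"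
      unfolding G_def by blast
    then show ?thesis unfolding G_def
      by (intro exI[of _ "\<lambda>n. X n + X' n"] exI[of _ "z + z'"]) (simp add: B.add T.add tendsto_add)
  qed
  \<comment> \<open>One invariance argument serves twice: for real scalings, giving homogeneity of
    \<open>V\<close> here, and for arbitrary commuting operators in the last conclusion.\<close>
  have G_com: "G (C y) (C w)"
    if G: "G y w" and C: "bounded_linear C" "\<And>x. C (B x) = B (C x)" "\<And>x. C (T x) = T (C x)" for C y w
  proof -
    interpret C: bounded_linear C by fact
    from G obtain X z where X: "(\<lambda>n. B (X n)) \<longlonglongrightarrow> z" "(\<lambda>n. T (X n)) \<longlonglongrightarrow> w" "B z = B y"
      unfolding G_def by blast
    have "(\<lambda>n. B (C (X n))) \<longlonglongrightarrow> C z" "(\<lambda>n. T (C (X n))) \<longlonglongrightarrow> C w" "B (C z) = B (C y)"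
      using C.tendsto[OF X(1)] C.tendsto[OF X(2)] X(3) by (simp_all add: C(2,3)) (simp flip: C(2))
    then show ?thesis
      unfolding G_def by (intro exI[of _ "\<lambda>n. C (X n)"] exI[of _ "C z"]) simp
  qed
  have G_scale: "G (r *\<^sub>R y) (r *\<^sub>R w)" if "G y w" for r y w
    by (rule G_com[OF that bounded_linear_scaleR_right]) (simp_all add: B.scaleR T.scaleR)
  \<comment> \<open>The difference \<open>w - w'\<close> is related to 0, and related pairs satisfy
    the norm bound \<open>G_le\<close>.\<close>
  have G_unique: "w = w'" if "G y w" "G y w'" for y w w'
    using G_le[OF G_add[OF that(1) G_scale[OF that(2), of "-1"]]] by simp
  from G_ex obtain V where V: "\<And>y. G y (V y)" by metis
  have V_eqI: "V y = w" if "G y w" for y w using G_unique[OF V that] .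
  have V0: "V x = 0 \<longleftrightarrow> B x = 0" for x
  proof -
    obtain z where z: "z \<in> closure (range B)" "B z = B x" "norm (V x) = norm z"
      using G_norm[OF V, of x] by blast
    have "z = 0 \<longleftrightarrow> B z = 0"
      using selfadjoint_null_closure_range[OF B(2) z(1), of z] by (auto simp: B.zero)
    then show ?thesis using z by (metis norm_eq_zero)
  qed
  show ?thesis
  proof (rule that[of V])
    show "bounded_linear V"
    proof (rule bounded_linear_intro)
      show "V (x + y) = V x + V y" for x y by (rule V_eqI[OF G_add[OF V V]])
      show "V (r *\<^sub>R x) = r *\<^sub>R V x" for r x by (rule V_eqI[OF G_scale[OF V]])
      show "norm (V x) \<le> norm x * 1" for x using G_le[OF V] by simp
    qed
    show "V (B x) = T x" for x
      by (rule V_eqI) (auto simp: G_def intro!: exI[of _ "\<lambda>_. x"] exI[of _ "B x"])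
    show "V x = 0 \<longleftrightarrow> T x = 0" for x using V0[of x] BT[of x] by (metis norm_eq_zero)
    show "norm (V x) = norm x" if x: "\<And>z. V z = 0 \<Longrightarrow> x \<bullet> z = 0" for x
    proof -
      obtain z where z: "B z = B x" "norm (V x) = norm z" "z \<bullet> (x - z) = 0"
        using G_norm[OF V, of x] by blast
      have "V (x - z) = 0" using z(1) by (simp add: V0 B.diff)
      from x[OF this] z(3) have "(x - z) \<bullet> (x - z) = 0" by (simp add: inner_diff_left)
      then show ?thesis using z(2) by simp
    qed
    show "C (V x) = V (C x)"
      if "bounded_linear C" "\<And>x. C (B x) = B (C x)" "\<And>x. C (T x) = T (C x)" for C x
      by (rule V_eqI[symmetric, OF G_com[OF V that]])
  qed
qed

text \<open>Let D be the adjoint of V - W. Since (V - W) B = 0, also B D = 0, so the kernel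
  hypotheses give (V - W) D = 0. Hence D y . D y = (V - W) (D y) . y = 0 and D vanishes.\<close>

lemma polar_unique:
  fixes B V W :: "'v::{real_inner, complete_space} \<Rightarrow> 'v"
  assumes B: "\<And>x y. B x \<bullet> y = x \<bullet> B y"
    and V: "bounded_linear V" "\<And>x. B x = 0 \<Longrightarrow> V x = 0"
    and W: "bounded_linear W" "\<And>x. B x = 0 \<Longrightarrow> W x = 0"
    and eq: "\<And>x. V (B x) = W (B x)"
  shows "V = W"
proof -
  obtain D where D: "\<And>x y. (V x - W x) \<bullet> y = x \<bullet> D y"
    using adjoint_exists[OF bounded_linear_sub[OF V(1) W(1)]] by metis
  have "B (D y) \<bullet> x = 0" for x y
    by (simp add: B inner_commute[of "D y"] flip: D) (simp add: eq)
  then have "B (D y) = 0" for y by (subst eq_0_iff_inner) simp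
  then have "V (D y) - W (D y) = 0" for y by (simp add: V(2) W(2))
  then have "D y \<bullet> D y = 0" for y using D[of "D y" y] by simp
  then have "(V x - W x) \<bullet> y = 0" for x y by (simp add: D)
  then show ?thesis using eq_0_iff_inner[of "V x - W x" for x] by fastforce
qed

section \<open>Operators commuting with the scalars\<close>

lemma conj_0: "conj (0 :: 'k::rc_field) = 0"
  using conj_add[of "0::'k" 0] by simp

context hilbert_space
begin

section \<open>Recovering the scalar-valued inner product from the real one\<close>

lemma ip_add_right: "ip x (y + z) = ip x y + ip x z"
  by (metis ip_commute ip_add_left conj_add)

lemma ip_sm_right: "ip x (sm c y) = conj c * ip x y"
  by (metis ip_commute ip_sm_left conj_mult)

text \<open>Polarization of \<open>ip_self\<close>. The scalar class has no real part operation, so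
  the sum with the swapped product stands in for twice the real part.\<close>

lemma ip_plus_swap: "ip x y + ip y x = of_real (2 * (x \<bullet> y))"
proof -
  have "ip (x + y) (x + y) = ip x x + ip y y + (ip x y + ip y x)"
    by (simp add: ip_add_left ip_add_right)
  then show ?thesis
    by (simp add: ip_self inner_add_left inner_add_right inner_commute[of y x])
qed

lemma inner_sm: "sm c x \<bullet> y = x \<bullet> sm (conj c) y"
proof -
  have "(of_real (2 * (sm c x \<bullet> y)) :: 'k) = of_real (2 * (x \<bullet> sm (conj c) y))"
    unfolding ip_plus_swap[symmetric] ip_sm_left ip_sm_right conj_conj ..
  then show ?thesis by (simp only: of_real_eq_iff)
qed

text \<open>Real inner products against all scalar multiples determine \<open>ip\<close>: the
  difference d satisfies c d + conj (c d) = 0 for every c, and the choice c = conj d turns this into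
  twice the squared norm of d.\<close>

lemma ip_eqI:
  assumes "\<And>c. sm c x \<bullet> y = sm c x' \<bullet> y'"
  shows "ip x y = ip x' y'"
proof -
  define d where "d = ip x y - ip x' y'"
  have "ip (sm c x) y + ip y (sm c x) = ip (sm c x') y' + ip y' (sm c x')" for c
    by (simp add: ip_plus_swap assms)
  then have e: "c * ip x y + conj c * conj (ip x y) = c * ip x' y' + conj c * conj (ip x' y')" for c
    by (simp add: ip_sm_left ip_sm_right flip: ip_commute)
  have cd: "conj d + conj (ip x' y') = conj (ip x y)"
    by (simp add: d_def flip: conj_add)
  have "c * d + conj c * conj d = 0" for c
    using e[of c] unfolding cd[symmetric] by (simp add: d_def algebra_simps)
  from this[of "conj d"] have "d * conj d + d * conj d = 0" by (simp add: conj_conj mult.commute)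
  then have "d = 0" by (simp add: mult_conj flip: scaleR_2)
  then show ?thesis by (simp add: d_def)
qed

text \<open>This admits \<open>sm c\<close> as the commuting operator in the last clauses of
  \<open>positive_sqrt_exists\<close> and \<open>polar_extension\<close>, which is how their results
  become linear over the scalar field.\<close>

lemma bounded_linear_sm: "bounded_linear (sm c)"
proof (rule bounded_linear_intro)
  show "sm c (x + y) = sm c x + sm c y" for x y by (rule scale_right_distrib)
  show "sm c (r *\<^sub>R x) = r *\<^sub>R sm c x" for r x
    by (simp add: mult.commute flip: sm_of_real)
  have "(norm (sm c x))\<^sup>2 = (norm c * norm x)\<^sup>2" for x
  proof -
    have "conj c * c = of_real ((norm c)\<^sup>2)"
      by (metis mult.commute mult_conj of_real_def)
    then have "sm c x \<bullet> sm c x = (norm c)\<^sup>2 * (x \<bullet> x)"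
      by (simp add: inner_sm sm_of_real del: of_real_power)
    then show ?thesis by (simp add: power2_norm_eq_inner power_mult_distrib)
  qed
  then have "norm (sm c x) = norm c * norm x" for x
    by (rule power2_eq_imp_eq) simp_all
  then show "norm (sm c x) \<le> norm x * norm c" for x
    by (simp add: mult.commute)
qed

lemma ip_adjointI:
  assumes "\<And>c x. A (sm c x) = sm c (A x)" and "\<And>x y. A x \<bullet> y = x \<bullet> B y"
  shows "ip (A x) y = ip x (B y)"
  by (rule ip_eqI) (metis assms)

lemma inner_adjointI:
  assumes "\<And>x y. ip (A x) y = ip x (B y)"
  shows "A x \<bullet> y = x \<bullet> B y"
proof -
  have "ip y (A x) = ip (B y) x" by (metis assms ip_commute)
  then have "(of_real (2 * (A x \<bullet> y)) :: 'k) = of_real (2 * (x \<bullet> B y))"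
    by (simp only: ip_plus_swap[symmetric] assms)
  then show ?thesis by (simp only: of_real_eq_iff)
qed

section \<open>Adjoints, positivity, projections and partial isometries through the real inner
  product\<close>

lemma bounded_opD:
  assumes "bounded_op sm A"
  shows "bounded_linear A" "A (sm c x) = sm c (A x)"
  using assms by (auto simp: bounded_op_def)

text \<open>For a scalar-linear operator a real adjoint is automatically an
  \<open>ip\<close>-adjoint, so the definite description picks out the operator produced by the real
  theory.\<close>

lemma adj_eqI:
  assumes A: "\<And>c x. A (sm c x) = sm c (A x)" and AB: "\<And>x y. A x \<bullet> y = x \<bullet> B y"
  shows "adj ip A = B"
  unfolding adj_def
proof (rule the_equality)
  show "\<forall>x y. ip (A x) y = ip x (B y)" using ip_adjointI[OF assms] by blast
  show "B' = B" if "\<forall>x y. ip (A x) y = ip x (B' y)" for B'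
  proof
    fix y
    have "B' y \<bullet> x = B y \<bullet> x" for x
      using inner_adjointI[of A B' x y] that AB[of x y] by (simp add: inner_commute)
    then show "B' y = B y" by (subst eq_iff_inner) blast
  qed
qed

lemma adj_inner:
  assumes A: "bounded_op sm A"
  shows "A x \<bullet> y = x \<bullet> adj ip A y"
  using adjoint_exists[OF bounded_opD(1)[OF A]] adj_eqI[OF bounded_opD(2)[OF A]] by metis

lemma bounded_op_adj:
  assumes A: "bounded_op sm A"
  shows "bounded_op sm (adj ip A)"
proof -
  have "bounded_linear (adj ip A)"
    using adjoint_exists[OF bounded_opD(1)[OF A]] adj_eqI[OF bounded_opD(2)[OF A]] by metis
  moreover have "adj ip A (sm c y) = sm c (adj ip A y)" for c y
    unfolding eq_iff_inner[of "adj ip A (sm c y)"]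
  proof
    fix x
    have "x \<bullet> adj ip A (sm c y) = sm (conj c) (A x) \<bullet> y"
      by (simp add: inner_sm conj_conj flip: adj_inner[OF A])
    also have "\<dots> = x \<bullet> sm c (adj ip A y)"
      by (simp add: bounded_opD(2)[OF A, symmetric] adj_inner[OF A] inner_sm conj_conj)
    finally show "adj ip A (sm c y) \<bullet> x = sm c (adj ip A y) \<bullet> x" by (simp add: inner_commute)
  qed
  ultimately show ?thesis by (simp add: bounded_op_def)
qed

lemma bounded_op_comp: "bounded_op sm A \<Longrightarrow> bounded_op sm B \<Longrightarrow> bounded_op sm (A \<circ> B)"
  by (auto simp: bounded_op_def o_def intro: bounded_linear_compose)

lemma selfadjoint_iff:
  assumes A: "bounded_op sm A"
  shows "adj ip A = A \<longleftrightarrow> (\<forall>x y. A x \<bullet> y = x \<bullet> A y)"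
  using adj_inner[OF A] adj_eqI[OF bounded_opD(2)[OF A]] by metis

text \<open>For symmetric scalar-linear \<open>A\<close> the values \<open>ip (A x) x\<close> and
  \<open>ip x (A x)\<close> agree, so each is the real number
  \<open>A x \<bullet> x\<close>.\<close>

lemma pos_op_iff:
  "pos_op sm ip A \<longleftrightarrow> bounded_op sm A \<and> (\<forall>x y. A x \<bullet> y = x \<bullet> A y) \<and> (\<forall>x. A x \<bullet> x \<ge> 0)"
proof -
  have "ip (A x) x = of_real (A x \<bullet> x)"
    if A: "bounded_op sm A" "\<forall>x y. A x \<bullet> y = x \<bullet> A y" for x
  proof -
    have "ip (A x) x = ip x (A x)" using ip_adjointI[of A A] bounded_opD(2)[OF A(1)] A(2) by blast
    then have "2 * ip (A x) x = 2 * of_real (A x \<bullet> x)"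
      using ip_plus_swap[of "A x" x] by simp
    then show ?thesis by simp
  qed
  then show ?thesis
    unfolding pos_op_def using selfadjoint_iff[of A] nonneg_Reals_of_real_iff
    by (metis (no_types, lifting))
qed

lemma orth_projection_iff:
  "orth_projection sm ip P \<longleftrightarrow>
     bounded_op sm P \<and> (\<forall>x. P (P x) = P x) \<and> (\<forall>x y. P x \<bullet> y = x \<bullet> P y)"
  unfolding orth_projection_def using selfadjoint_iff[of P] by (auto simp: fun_eq_iff)

lemma orth_projection_contraction:
  assumes "orth_projection sm ip P"
  shows "norm (P x) \<le> norm x"
proof (cases "P x = 0")
  case False
  have "norm (P x) * norm (P x) = P x \<bullet> x"
    using assms unfolding orth_projection_iff
    by (metis power2_eq_square power2_norm_eq_inner)
  also have "\<dots> \<le> norm (P x) * norm x" by (rule norm_cauchy_schwarz)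
  finally show ?thesis using False by simp
qed simp

text \<open>The nullspace is closed under scalar multiplication, so real orthogonality to it already
  implies orthogonality for \<open>ip\<close>.\<close>

lemma partial_isometry_iff:
  "partial_isometry sm ip V \<longleftrightarrow>
    bounded_op sm V \<and> (\<forall>x. (\<forall>z. V z = 0 \<longrightarrow> x \<bullet> z = 0) \<longrightarrow> norm (V x) = norm x)"
proof -
  have "(\<forall>z\<in>nullspace V. ip x z = 0) \<longleftrightarrow> (\<forall>z. V z = 0 \<longrightarrow> x \<bullet> z = 0)"
    if V: "bounded_op sm V" for x
  proof safe
    fix z assume *: "\<forall>z\<in>nullspace V. ip x z = 0" "V z = 0"
    then have "ip x z = 0" by (simp add: nullspace_def)
    moreover from this have "ip z x = 0" by (metis ip_commute conj_0)
    ultimately have "(of_real (2 * (x \<bullet> z)) :: 'k) = 0" using ip_plus_swap[of x z] by simp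
    then show "x \<bullet> z = 0" by (simp only: of_real_eq_0_iff)
  next
    fix z assume *: "\<forall>z. V z = 0 \<longrightarrow> x \<bullet> z = 0" "z \<in> nullspace V"
    have "V (sm (conj c) z) = 0" for c
      using *(2) bounded_opD(2)[OF V] by (simp add: nullspace_def)
    then have "sm c x \<bullet> z = sm c 0 \<bullet> 0" for c using *(1) by (simp add: inner_sm)
    then have "ip x z = ip 0 0" by (rule ip_eqI)
    then show "ip x z = 0" by (simp add: ip_self)
  qed
  then show ?thesis unfolding partial_isometry_def by auto
qed

lemma partial_isometry_adj:
  assumes V: "partial_isometry sm ip V"
  shows "V (adj ip V (V x)) = V x" "adj ip V (V (adj ip V x)) = adj ip V x"
proof -
  have bV: "bounded_op sm V" using V by (simp add: partial_isometry_iff)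
  let ?W = "adj ip V"
  interpret V: bounded_linear V by (rule bounded_opD[OF bV])
  interpret W: bounded_linear ?W by (rule bounded_opD[OF bounded_op_adj[OF bV]])
  have iso: "norm (V x) = norm x" if "\<And>z. V z = 0 \<Longrightarrow> x \<bullet> z = 0" for x
    using V that by (auto simp: partial_isometry_iff)
  have W: "?W y \<bullet> z = 0" if "V z = 0" for y z
    using adj_inner[OF bV, of z y] that by (simp add: inner_commute)
  have main: "?W (V x) = x" if x: "\<And>z. V z = 0 \<Longrightarrow> x \<bullet> z = 0" for x
  proof -
    have sq: "V u \<bullet> V u = u \<bullet> u" if "\<And>z. V z = 0 \<Longrightarrow> u \<bullet> z = 0" for u
      using iso[OF that] by (simp flip: power2_norm_eq_inner)
    \<comment> \<open>The error \<open>y\<close> is itself orthogonal to the nullspace, so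
      \<open>V\<close> is isometric on \<open>x\<close>, \<open>y\<close> and \<open>x + y\<close>.
      Polarization makes \<open>y\<close> orthogonal to itself.\<close>
    define y where "y = ?W (V x) - x"
    have y: "y \<bullet> z = 0" if "V z = 0" for z
      using that W x by (simp add: y_def inner_diff_left)
    have "V (x + y) \<bullet> V (x + y) = (x + y) \<bullet> (x + y)"
      by (rule sq) (use x y in \<open>simp add: inner_add_left\<close>)
    then have "V x \<bullet> V y = x \<bullet> y"
      using sq[OF x] sq[OF y]
      by (simp add: V.add inner_add_left inner_add_right inner_commute[of "V y" "V x"] inner_commute[of y x])
    then have "?W (V x) \<bullet> y = x \<bullet> y"
      using adj_inner[OF bV, of y "V x"] by (simp add: inner_commute)
    then have "y \<bullet> y = 0" by (simp add: y_def inner_diff_left)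
    then show ?thesis by (simp add: y_def)
  qed
  show WVW: "?W (V (?W x)) = ?W x" for x
    by (rule main) (rule W)
  show "V (?W (V x)) = V x" for x
  proof -
    define d where "d = ?W (V x) - x"
    have "?W (V d) = 0" by (simp add: d_def V.diff W.diff WVW)
    then have "V d \<bullet> V d = 0" by (simp add: adj_inner[OF bV])
    then show ?thesis by (simp add: d_def V.diff)
  qed
qed

text \<open>Contractivity is inherited from the square root construction; products of two orthogonal
  projections satisfy it.\<close>

lemma modulus_eqI:
  assumes T: "bounded_op sm T" "\<And>x. norm (T x) \<le> norm x"
    and M: "pos_op sm ip M" "M \<circ> M = adj ip T \<circ> T"
  shows "modulus sm ip T = M"
  unfolding modulus_def
proof (rule the_equality)
  show "B = M" if B: "pos_op sm ip B \<and> B \<circ> B = adj ip T \<circ> T" for B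
    by (rule positive_sqrt_unique[OF bounded_opD(1)[OF T(1)] T(2)
          bounded_opD(1)[OF bounded_op_adj[OF T(1)]] adj_inner[OF T(1)]])
      (use B M in \<open>auto simp: pos_op_iff bounded_op_def fun_eq_iff\<close>)
qed (use M in blast)

lemma isometric_part_eqI:
  assumes T: "bounded_op sm T" "\<And>x. norm (T x) \<le> norm x"
    and M: "pos_op sm ip M" "M \<circ> M = adj ip T \<circ> T"
    and V: "partial_isometry sm ip V" "nullspace V = nullspace T" "T = V \<circ> M"
  shows "isometric_part sm ip T = V"
  unfolding isometric_part_def modulus_eqI[OF T M]
proof (rule the_equality)
  fix W assume W: "partial_isometry sm ip W \<and> nullspace W = nullspace T \<and> T = W \<circ> M"
  have bV: "bounded_linear V" and bW: "bounded_linear W"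
    using V W by (auto simp: partial_isometry_iff bounded_op_def)
  have sub: "W x = 0 \<and> V x = 0" if "M x = 0" for x
  proof -
    have "T x = 0" using V(3) that by (simp add: linear_0[OF bounded_linear.linear[OF bV]])
    then show ?thesis using V W by (auto simp: nullspace_def)
  qed
  show "W = V"
  proof (rule polar_unique[of M])
    show "W (M x) = V (M x)" for x using V(3) W by (metis comp_apply)
  qed (use M sub bV bW in \<open>auto simp: pos_op_iff\<close>)
qed (use V in blast)

text \<open>The real constructions are scalar-linear: \<open>sm c\<close> commutes with
  \<open>T\<close> and its adjoint, hence with the root \<open>M\<close>, hence with the isometric
  part.\<close>

lemma polar_decomposition:
  assumes T: "bounded_op sm T" "\<And>x. norm (T x) \<le> norm x"
  obtains M where "pos_op sm ip M" "M \<circ> M = adj ip T \<circ> T" "T = isometric_part sm ip T \<circ> M"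
    "partial_isometry sm ip (isometric_part sm ip T)" "nullspace (isometric_part sm ip T) = nullspace T"
proof -
  have bT: "bounded_linear T" and cT: "\<And>c x. T (sm c x) = sm c (T x)" using T(1) by (auto simp: bounded_op_def)
  have bT': "bounded_linear (adj ip T)" and cT': "\<And>c x. adj ip T (sm c x) = sm c (adj ip T x)"
    using bounded_op_adj[OF T(1)] by (auto simp: bounded_op_def)
  obtain M where M: "bounded_linear M" "\<And>x y. M x \<bullet> y = x \<bullet> M y" "\<And>x. M x \<bullet> x \<ge> 0"
    "\<And>x. M (M x) = adj ip T (T x)"
    "\<And>C x. bounded_linear C \<Longrightarrow> (\<And>x. C (adj ip T (T x)) = adj ip T (T (C x))) \<Longrightarrow> C (M x) = M (C x)"
    using positive_sqrt_exists[OF bT T(2) bT' adj_inner[OF T(1)]] by blast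
  have cM: "sm c (M x) = M (sm c x)" for c x
    by (rule M(5)[OF bounded_linear_sm]) (simp add: cT cT')
  have pM: "pos_op sm ip M" using M cM by (simp add: pos_op_iff bounded_op_def)
  have MM: "M \<circ> M = adj ip T \<circ> T" by (simp add: fun_eq_iff M(4))
  have "T x \<bullet> T x = M x \<bullet> M x" for x by (simp add: adj_inner[OF T(1)] M(2,4))
  then have "norm (T x) = norm (M x)" for x by (simp add: norm_eq)
  from polar_extension[OF M(1,2) bT this] obtain V where V: "bounded_linear V" "\<And>x. V (M x) = T x"
    "\<And>x. V x = 0 \<longleftrightarrow> T x = 0" "\<And>x. (\<And>z. V z = 0 \<Longrightarrow> x \<bullet> z = 0) \<Longrightarrow> norm (V x) = norm x"
    "\<And>C x. bounded_linear C \<Longrightarrow> (\<And>x. C (M x) = M (C x)) \<Longrightarrow> (\<And>x. C (T x) = T (C x)) \<Longrightarrow> C (V x) = V (C x)"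
    by blast
  have "sm c (V x) = V (sm c x)" for c x
    by (rule V(5)[OF bounded_linear_sm]) (simp_all add: cT cM)
  then have pV: "partial_isometry sm ip V" using V(1,4) by (simp add: partial_isometry_iff bounded_op_def)
  have nV: "nullspace V = nullspace T" using V(3) by (simp add: nullspace_def)
  have TV: "T = V \<circ> M" by (simp add: fun_eq_iff V(2))
  show ?thesis
    by (rule that[OF pM MM]) (use isometric_part_eqI[OF T pM MM pV nV TV] pV nV TV in auto)
qed

section \<open>Isometric parts of products of two projections\<close>

text \<open>The second conclusion is the range condition in kernel form: for a symmetric operator
  the closure of the range is the orthogonal complement of the kernel.\<close>

lemma positive_if_isometric_part:
  assumes V: "V \<in> proj_product_isometric_parts sm ip"
  shows "pos_op sm ip (V \<circ> V \<circ> adj ip V)"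
    and "\<And>z. V (V (adj ip V z)) = 0 \<Longrightarrow> adj ip V z = 0"
proof -
  obtain P Q where P: "orth_projection sm ip P" and Q: "orth_projection sm ip Q"
    and VPQ: "V = isometric_part sm ip (P \<circ> Q)"
    using V by (auto simp: proj_product_isometric_parts_def proj_products_def)
  define T where "T = P \<circ> Q"
  have bT: "bounded_op sm T"
    using P Q by (simp add: T_def orth_projection_iff bounded_op_comp)
  have nT: "norm (T x) \<le> norm x" for x
    using orth_projection_contraction[OF P, of "Q x"] orth_projection_contraction[OF Q, of x]
    by (simp add: T_def)
  have T': "adj ip T = Q \<circ> P"
    by (rule adj_eqI) (use P Q bounded_opD(2)[OF bT] in \<open>simp_all add: T_def orth_projection_iff\<close>)
  obtain M where M: "pos_op sm ip M" "M \<circ> M = adj ip T \<circ> T" "T = V \<circ> M"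
    "partial_isometry sm ip V" "nullspace V = nullspace T"
    using polar_decomposition[OF bT nT] unfolding VPQ T_def by blast
  let ?W = "adj ip V"
  have bV: "bounded_op sm V" using M(4) by (simp add: partial_isometry_iff)
  have bW: "bounded_op sm ?W" by (rule bounded_op_adj[OF bV])
  have bM: "bounded_op sm M" and sM: "\<And>x y. M x \<bullet> y = x \<bullet> M y" and M0: "\<And>x. M x \<bullet> x \<ge> 0"
    using M(1) by (auto simp: pos_op_iff)
  interpret V: bounded_linear V by (rule bounded_opD[OF bV])
  interpret M: bounded_linear M by (rule bounded_opD[OF bM])
  interpret W: bounded_linear ?W by (rule bounded_opD[OF bW])
  have TVM: "T x = V (M x)" for x
    using M(3) by (simp add: fun_eq_iff)
  have MMT: "M (M x) = adj ip T (T x)" for x using M(2) by (simp add: fun_eq_iff)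
  have V_M_0: "V x = 0 \<longleftrightarrow> M x = 0" for x
  proof -
    have "V x = 0 \<longleftrightarrow> T x = 0" using M(5) by (auto simp: nullspace_def)
    moreover have "T x \<bullet> T x = M x \<bullet> M x" by (simp add: adj_inner[OF bT] sM MMT)
    ultimately show ?thesis by (metis inner_eq_zero_iff)
  qed
  have M_0: "M x = 0" if "M (M x) = 0" for x
    using sM[of x "M x"] that by simp
  \<comment> \<open>The error \<open>d\<close> lies in the common kernel of \<open>V\<close> and
    \<open>M\<close>, which is orthogonal to both of its terms.\<close>
  have WVM: "?W (V (M x)) = M x" for x
  proof -
    define d where "d = ?W (V (M x)) - M x"
    have "V d = 0" by (simp add: d_def V.diff partial_isometry_adj[OF M(4)])
    then have "M d = 0" "V d = 0" by (simp_all add: V_M_0)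
    then have "d \<bullet> M x = 0" "d \<bullet> ?W (V (M x)) = 0"
      using sM[of d x] adj_inner[OF bV, of d] by simp_all
    then have "d \<bullet> d = 0" by (simp add: d_def inner_diff_right)
    then show ?thesis by (simp add: d_def)
  qed
  have "V (M (M (M x))) = V (M (V (M x)))" for x
  proof -
    have "T (adj ip T (T x)) = T (T x)"
      unfolding T' using P Q by (simp add: T_def orth_projection_iff)
    then show ?thesis by (simp flip: TVM MMT)
  qed
  \<comment> \<open>Applying \<open>?W\<close> cancels the outer \<open>V\<close> by
    \<open>WVM\<close>. Next the outer \<open>M\<close> is traded for \<open>V\<close>, as the two
    have the same kernel.\<close>
  then have "M (M (M x)) = M (V (M x))" for x by (metis WVM)
  then have "M (M (M x) - V (M x)) = 0" for x by (simp add: M.diff)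
  then have "V (M (M x)) - V (V (M x)) = 0" for x by (simp add: V.diff flip: V_M_0)
  then have VMM: "V (M (M x)) = V (V (M x))" for x by simp
  have A: "V (V (?W y)) = V (M (?W y))" for y
  proof -
    \<comment> \<open>\<open>E\<close> is the adjoint of V M - V V. By \<open>VMM\<close> that
      operator vanishes on the range of \<open>M\<close>, so M E = 0, hence V E = 0; the adjoint of
      this last identity is (V M - V V) ?W = 0.\<close>
    define E where "E = (\<lambda>y. M (?W y) - ?W (?W y))"
    have E: "(V (M x) - V (V x)) \<bullet> y = x \<bullet> E y" for x y
      by (simp add: E_def inner_diff_left inner_diff_right sM adj_inner[OF bV])
    have "M (E y) \<bullet> x = 0" for x y
      using E[of "M x" y] VMM[of x] by (simp add: sM inner_commute[of "E y"])
    then have "V (E z) = 0" for z by (metis V_M_0 eq_0_iff_inner)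
    then have "(V (M (?W y)) - V (V (?W y))) \<bullet> z = 0" for z
      by (simp add: E adj_inner[OF bV, of "E z" y, symmetric] inner_commute[of "?W y"])
    then show ?thesis by (metis eq_0_iff_inner right_minus_eq)
  qed
  have WV: "?W x \<bullet> y = x \<bullet> V y" for x y
    using adj_inner[OF bV, of y x] by (simp add: inner_commute)
  show "pos_op sm ip (V \<circ> V \<circ> ?W)"
    unfolding pos_op_iff
  proof safe
    show "bounded_op sm (V \<circ> V \<circ> ?W)" by (simp add: bounded_op_comp bV bW)
    show "(V \<circ> V \<circ> ?W) x \<bullet> y = x \<bullet> (V \<circ> V \<circ> ?W) y" for x y
      by (simp add: A adj_inner[OF bV] sM) (simp add: WV)
    show "(V \<circ> V \<circ> ?W) x \<bullet> x \<ge> 0" for x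
      by (simp add: A adj_inner[OF bV] M0)
  qed
  show "?W z = 0" if "V (V (?W z)) = 0" for z
  proof -
    have "M (M (?W z)) = 0" using that by (simp add: A V_M_0)
    then have "V (?W z) = 0" using M_0[of "?W z"] by (simp add: V_M_0)
    then show ?thesis using partial_isometry_adj(2)[OF M(4), of z] by (simp add: W.zero)
  qed
qed

lemma isometric_part_of_squareI:
  assumes V: "partial_isometry sm ip V"
    and pos: "pos_op sm ip (V \<circ> V \<circ> adj ip V)"
    and null: "nullspace (V \<circ> V) = nullspace V"
  shows "V \<in> proj_product_isometric_parts sm ip"
proof -
  let ?W = "adj ip V"
  have bV: "bounded_op sm V" using V by (simp add: partial_isometry_iff)
  have bW: "bounded_op sm ?W" by (rule bounded_op_adj[OF bV])
  note VW = adj_inner[OF bV]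
  have WV: "?W x \<bullet> y = x \<bullet> V y" for x y
    using VW[of y x] by (simp add: inner_commute)
  note pi = partial_isometry_adj[OF V]
  \<comment> \<open>Self-adjointness written out: the right side is the adjoint of
    \<open>V \<circ> V \<circ> ?W\<close>.\<close>
  have A: "V (V (?W y)) = V (?W (?W y))" for y
  proof -
    have "V (V (?W y)) \<bullet> z = V (?W (?W y)) \<bullet> z" for z
      using pos by (simp add: pos_op_iff) (simp add: VW WV)
    then show ?thesis by (subst eq_iff_inner) blast
  qed
  define M where "M = ?W \<circ> V \<circ> V"
  have P: "orth_projection sm ip (V \<circ> ?W)" and Q: "orth_projection sm ip (?W \<circ> V)"
    by (simp_all add: orth_projection_iff bounded_op_comp bV bW pi VW WV)
  have PQ: "(V \<circ> ?W) \<circ> (?W \<circ> V) = V \<circ> V"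
    using A[of "V x" for x] by (simp add: fun_eq_iff pi)
  \<comment> \<open>The first form shows positivity, as a conjugate of
    \<open>V \<circ> V \<circ> ?W\<close>; the second is the adjoint of the defining form, giving
    symmetry and the square of \<open>M\<close>.\<close>
  have M: "M x = ?W (V (V (?W (V x))))" "M x = ?W (?W (V x))" for x
  proof -
    show "M x = ?W (V (V (?W (V x))))" by (simp add: M_def pi)
    show "M x = ?W (?W (V x))" using A[of "V x"] by (simp add: M_def pi)
  qed
  have pM: "pos_op sm ip M"
    unfolding pos_op_iff
  proof safe
    show "bounded_op sm M" by (simp add: M_def bounded_op_comp bV bW)
    show "M x \<bullet> y = x \<bullet> M y" for x y
      by (subst M(2)) (simp add: WV M_def VW)
    show "M x \<bullet> x \<ge> 0" for x
    proof -
      have "(V \<circ> V \<circ> ?W) (V x) \<bullet> V x \<ge> 0" using pos unfolding pos_op_iff by blast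
      then show ?thesis by (simp add: M(1) WV)
    qed
  qed
  have bVV: "bounded_op sm (V \<circ> V)" by (simp add: bounded_op_comp bV)
  have nVV: "norm ((V \<circ> V) x) \<le> norm x" for x
    using order_trans[OF orth_projection_contraction[OF P, of "(?W \<circ> V) x"] orth_projection_contraction[OF Q, of x]]
      fun_cong[OF PQ, of x] by simp
  have "adj ip (V \<circ> V) = ?W \<circ> ?W"
    by (rule adj_eqI) (use bounded_opD(2)[OF bV] in \<open>simp_all add: VW\<close>)
  moreover have "M (M x) = ?W (?W (V (V x)))" for x
    by (subst M(2)) (simp add: M_def pi)
  ultimately have MM: "M \<circ> M = adj ip (V \<circ> V) \<circ> (V \<circ> V)" by (simp add: fun_eq_iff)
  have "isometric_part sm ip (V \<circ> V) = V"
    by (rule isometric_part_eqI[OF bVV nVV pM MM V]) (simp_all add: null M_def fun_eq_iff pi)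
  moreover have "V \<circ> V \<in> proj_products sm ip"
    unfolding proj_products_def using P Q PQ by (metis (mono_tags, lifting) mem_Collect_eq)
  ultimately show ?thesis unfolding proj_product_isometric_parts_def by (metis image_eqI)
qed

end

section \<open>From kernel conditions to closures of ranges, and density of R(V) + N(V)\<close>

theorem theorem5p2:
  fixes sm :: "'k::rc_field \<Rightarrow> 'v::{real_inner, complete_space} \<Rightarrow> 'v"
    and ip :: "'v \<Rightarrow> 'v \<Rightarrow> 'k"
    and V :: "'v \<Rightarrow> 'v"
  assumes "hilbert_space sm ip"
    and "partial_isometry sm ip V"
  shows "(V \<in> proj_product_isometric_parts sm ip \<longleftrightarrow>
            pos_op sm ip (V \<circ> V \<circ> adj ip V) \<and>
            closure (range (V \<circ> V \<circ> adj ip V)) = range V) \<and>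
         (V \<in> proj_product_isometric_parts sm ip \<longrightarrow>
            range V \<inter> nullspace V = {0} \<and>
            closure (range V + nullspace V) = UNIV)"
proof -
  interpret hilbert_space sm ip by fact
  let ?W = "adj ip V" and ?A = "V \<circ> V \<circ> adj ip V"
  have bV: "bounded_op sm V" using assms(2) by (simp add: partial_isometry_iff)
  have bW: "bounded_op sm ?W" by (rule bounded_op_adj[OF bV])
  interpret V: bounded_linear V by (rule bounded_opD[OF bV])
  interpret W: bounded_linear ?W by (rule bounded_opD[OF bW])
  note VW = adj_inner[OF bV]
  note pi = partial_isometry_adj[OF assms(2)]
  have lA: "linear ?A" by (intro linear_compose W.linear V.linear)
  have null_A: "?W z = 0"
    if pos: "pos_op sm ip ?A" and cl: "closure (range ?A) = range V" and z: "?A z = 0" for z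
  proof -
    have "z \<bullet> s = 0" if "s \<in> range ?A" for s
      using that pos z by (metis inner_zero_left pos_op_iff rangeE)
    then have "z \<bullet> V y = 0" for y
      using orthogonal_closure[of "range ?A" z "V y"] cl by blast
    then have "?W z \<bullet> y = 0" for y using VW[of y z] by (simp add: inner_commute)
    then show ?thesis by (subst eq_0_iff_inner) blast
  qed
  \<comment> \<open>R(V) is closed, being the fixed-point set of \<open>V \<circ> ?W\<close>.
    Conversely, if z is orthogonal to the range of \<open>?A\<close>, then
    \<open>?A z \<bullet> ?A z = z \<bullet> ?A (?A z) = 0\<close>, so \<open>?W z = 0\<close> and z
    is orthogonal to R(V).\<close>
  have closure_A: "closure (range ?A) = range V"
    if pos: "pos_op sm ip ?A" and null: "\<And>z. ?A z = 0 \<Longrightarrow> ?W z = 0"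
  proof
    have "closed {y. V (?W y) = y}"
      by (intro closed_Collect_eq continuous_on_id
          linear_continuous_on[OF bounded_linear_compose[OF V.bounded_linear_axioms W.bounded_linear_axioms]])
    moreover have "{y. V (?W y) = y} = range V" using pi(1) by (auto simp: image_iff) metis
    ultimately show "closure (range ?A) \<subseteq> range V"
      by (intro closure_minimal) auto
    show "range V \<subseteq> closure (range ?A)"
    proof clarify
      fix x
      show "V x \<in> closure (range ?A)"
      proof (rule mem_closure_subspaceI)
        show "real_vector.subspace (range ?A)" by (intro linear_subspace_image lA real_vector.subspace_UNIV)
        fix z assume z: "\<And>s. s \<in> range ?A \<Longrightarrow> z \<bullet> s = 0"
        have "?A z \<bullet> ?A z = z \<bullet> ?A (?A z)" using pos by (simp only: pos_op_iff)
        also have "\<dots> = 0" by (rule z) blast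
        finally have "?A z = 0" by simp
        then have "?W z = 0" by (rule null)
        then show "z \<bullet> V x = 0" using VW[of x z] by (simp add: inner_commute)
      qed
    qed
  qed
  \<comment> \<open>Since \<open>V \<circ> ?W\<close> fixes R(V), \<open>?A (V x) = V (V x)\<close>.
    The result gives both N(V V) = N(V) and the trivial intersection of R(V) with N(V).\<close>
  have VV: "V x = 0" if null: "\<And>z. ?A z = 0 \<Longrightarrow> ?W z = 0" and x: "V (V x) = 0" for x
  proof -
    have "?W (V x) = 0" by (rule null) (simp add: pi x)
    then show ?thesis using pi(1)[of x] by (simp add: V.zero)
  qed
  have iff: "V \<in> proj_product_isometric_parts sm ip \<longleftrightarrow>
      pos_op sm ip ?A \<and> closure (range ?A) = range V"
  proof
    assume "V \<in> proj_product_isometric_parts sm ip"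
    from positive_if_isometric_part[OF this]
    show "pos_op sm ip ?A \<and> closure (range ?A) = range V" using closure_A by simp
  next
    assume A: "pos_op sm ip ?A \<and> closure (range ?A) = range V"
    have "nullspace (V \<circ> V) = nullspace V"
    proof
      show "nullspace (V \<circ> V) \<subseteq> nullspace V"
        using VV[OF null_A] A unfolding nullspace_def o_apply by blast
    qed (auto simp: nullspace_def V.zero)
    then show "V \<in> proj_product_isometric_parts sm ip"
      using isometric_part_of_squareI[OF assms(2)] A by blast
  qed
  moreover have "range V \<inter> nullspace V = {0} \<and> closure (range V + nullspace V) = UNIV"
    if "V \<in> proj_product_isometric_parts sm ip"
  proof
    from that iff have A: "pos_op sm ip ?A" "closure (range ?A) = range V" by blast+
    have null: "?W z = 0" if "?A z = 0" for z by (rule null_A[OF A that])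
    show "range V \<inter> nullspace V = {0}"
    proof
      show "range V \<inter> nullspace V \<subseteq> {0}" using VV[OF null] unfolding nullspace_def by blast
      show "{0} \<subseteq> range V \<inter> nullspace V"
        using rangeI[of V 0] by (simp add: nullspace_def V.zero)
    qed
    have "real_vector.subspace (nullspace V)"
      by (auto simp: nullspace_def real_vector.subspace_def V.zero V.add V.scaleR)
    moreover have "real_vector.subspace (range V)"
      by (intro linear_subspace_image V.linear real_vector.subspace_UNIV)
    moreover have "range V + nullspace V = {x + y |x y. x \<in> range V \<and> y \<in> nullspace V}"
      unfolding set_plus_def by blast
    ultimately have sub: "real_vector.subspace (range V + nullspace V)"
      using real_vector.subspace_sums[of "range V" "nullspace V"] by simp
    \<comment> \<open>Orthogonality to N(V) gives \<open>?W (V z) = z\<close>. With orthogonality to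
      R(V), symmetry of \<open>?A\<close> then yields \<open>?A (V z) = 0\<close>, and the kernel
      condition forces \<open>?W (V z) = 0\<close>.\<close>
    have orth: "z = 0" if z: "\<And>s. s \<in> range V + nullspace V \<Longrightarrow> z \<bullet> s = 0" for z
    proof -
      have z1: "z \<bullet> V x = 0" for x
      proof -
        have "V x + 0 \<in> range V + nullspace V"
          by (rule set_plus_intro) (simp_all add: nullspace_def V.zero)
        from z[OF this] show ?thesis by simp
      qed
      have z2: "z \<bullet> n = 0" if "V n = 0" for n
      proof -
        have "V 0 + n \<in> range V + nullspace V"
          by (rule set_plus_intro[OF rangeI]) (simp add: nullspace_def that)
        from z[OF this] show ?thesis by (simp add: V.zero)
      qed
      define d where "d = ?W (V z) - z"
      have "V d = 0" by (simp add: d_def V.diff pi)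
      then have "z \<bullet> d = 0" "?W (V z) \<bullet> d = 0"
        using z2[of d] VW[of d "V z"] inner_commute[of d "?W (V z)"] by auto
      then have "d \<bullet> d = 0" by (simp add: d_def inner_diff_left)
      then have zW: "?W (V z) = z" by (simp add: d_def)
      have "?A (V z) \<bullet> y = 0" for y
      proof -
        have "?A (V z) \<bullet> y = V z \<bullet> ?A y" using A(1) by (simp only: pos_op_iff)
        also have "\<dots> = V (?W y) \<bullet> ?W (V z)"
          by (simp only: o_apply VW[of "V (?W y)" "V z"] inner_commute[of "V z" "V (V (?W y))"])
        also have "\<dots> = 0" using z1[of "?W y"] by (simp add: zW inner_commute)
        finally show ?thesis .
      qed
      then have "?A (V z) = 0" by (subst eq_0_iff_inner) blast
      then show "z = 0" using null zW by metis
    qed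
    have "y \<in> closure (range V + nullspace V)" for y
      by (rule mem_closure_subspaceI[OF sub]) (metis orth inner_zero_left)
    then show "closure (range V + nullspace V) = UNIV" by blast
  qed
  ultimately show ?thesis by blast
qed

end
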